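(* Let $A\in\mathbb{R}^{m\times n}$ and $H\in\mathbb{R}^{n\times m}$. Then $H$ satisfies all three of the conditions $AHA=A$, $(AH)^\top = AH$, and $(HA)^\top = HA$ (i.e., $H$ is an ah-ha-symmetric generalized inverse of $A$) if and only if $$A A^\top H^\top + H^\top A^\top A = 2A .$$
   Context: $H$ is a generalized inverse of $A$ if $AHA=A$; it is ah-ha-symmetric if both $AH$ and $HA$ are symmetric. *)

theory Defs
  imports "HOL-Analysis.Analysis"
begin

end

theory Submission
  imports Defs
begin

text \<open>
  The inner product on \<^typ>\<open>real ^ 'n ^ 'm\<close> is the Frobenius inner product, for which
  multiplication by a matrix (on either side) has multiplication by its transpose as adjoint.

  If \<open>H\<close> is an ah-ha-symmetric generalized inverse, each summand on the left is \<open>A\<close>. The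
  content of the converse is that one equation forces both \<open>A (H A)\<^sup>T = A\<close> and \<open>(A H)\<^sup>T A = A\<close>.
  Put \<open>K = A\<^sup>T H\<^sup>T A\<^sup>T - A\<^sup>T\<close>. Multiplying the equation by \<open>A\<^sup>T\<close> on both sides gives the
  homogeneous Sylvester equation \<open>A\<^sup>T A K + K A A\<^sup>T = 0\<close>. Pairing it with \<open>K\<close> yields
  \<open>\<parallel>A K\<parallel>\<^sup>2 + \<parallel>K A\<parallel>\<^sup>2 = 0\<close>, so that \<open>K A = 0\<close>, which reads
  \<open>A\<^sup>T ((A H)\<^sup>T A - A) = 0\<close>. Since \<open>(A H)\<^sup>T A - A\<close> is, by the equation, the negative of
  \<open>A (A\<^sup>T H\<^sup>T - I)\<close>, cancelling \<open>A\<^sup>T\<close> in front of \<open>A\<close> shows that both vanish.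

  Finally, \<open>(A H)\<^sup>T A = A\<close> gives \<open>(A H)\<^sup>T (A H) = A H\<close>, and a matrix of the form \<open>M\<^sup>T M\<close> is
  symmetric; likewise for \<open>H A\<close>. Then \<open>A H A = (A H)\<^sup>T A = A\<close>.
\<close>

lemma matrix_add_rdistrib:
  fixes A B :: "'a::semiring_1 ^ 'n ^ 'm" and C :: "'a ^ 'p ^ 'n"
  shows "(A + B) ** C = A ** C + B ** C"
  by (simp add: vec_eq_iff matrix_matrix_mult_def distrib_right sum.distrib)

lemma matrix_diff_ldistrib:
  fixes A :: "'a::ring_1 ^ 'n ^ 'm" and B C :: "'a ^ 'p ^ 'n"
  shows "A ** (B - C) = A ** B - A ** C"
  by (simp add: vec_eq_iff matrix_matrix_mult_def right_diff_distrib sum_subtractf)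

lemma matrix_diff_rdistrib:
  fixes A B :: "'a::ring_1 ^ 'n ^ 'm" and C :: "'a ^ 'p ^ 'n"
  shows "(A - B) ** C = A ** C - B ** C"
  by (simp add: vec_eq_iff matrix_matrix_mult_def left_diff_distrib sum_subtractf)

lemma inner_matrix_mul_left:
  fixes A :: "real ^ 'n ^ 'm" and X :: "real ^ 'p ^ 'n" and Y :: "real ^ 'p ^ 'm"
  shows "inner (A ** X) Y = inner X (transpose A ** Y)"
proof -
  have "inner (A ** X) Y = (\<Sum>i\<in>UNIV. \<Sum>j\<in>UNIV. \<Sum>k\<in>UNIV. A $ i $ k * X $ k $ j * Y $ i $ j)"
    by (simp add: inner_vec_def matrix_matrix_mult_def sum_distrib_right)
  also have "\<dots> = (\<Sum>i\<in>UNIV. \<Sum>k\<in>UNIV. \<Sum>j\<in>UNIV. A $ i $ k * X $ k $ j * Y $ i $ j)"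
    by (intro sum.cong refl sum.swap)
  also have "\<dots> = (\<Sum>k\<in>UNIV. \<Sum>i\<in>UNIV. \<Sum>j\<in>UNIV. A $ i $ k * X $ k $ j * Y $ i $ j)"
    by (rule sum.swap)
  also have "\<dots> = (\<Sum>k\<in>UNIV. \<Sum>j\<in>UNIV. \<Sum>i\<in>UNIV. A $ i $ k * X $ k $ j * Y $ i $ j)"
    by (intro sum.cong refl sum.swap)
  also have "\<dots> = inner X (transpose A ** Y)"
    by (simp add: inner_vec_def matrix_matrix_mult_def transpose_def sum_distrib_left mult_ac)
  finally show ?thesis .
qed

lemma inner_transpose_transpose:
  fixes X Y :: "real ^ 'n ^ 'm"
  shows "inner (transpose X) (transpose Y) = inner X Y"
  unfolding inner_vec_def transpose_def by (simp add: sum.swap[of _ "UNIV :: 'n set"])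

lemma inner_matrix_mul_right:
  fixes X :: "real ^ 'n ^ 'm" and B :: "real ^ 'p ^ 'n" and Y :: "real ^ 'p ^ 'm"
  shows "inner (X ** B) Y = inner X (Y ** transpose B)"
proof -
  have "inner (X ** B) Y = inner (transpose B ** transpose X) (transpose Y)"
    by (metis inner_transpose_transpose matrix_transpose_mul)
  also have "\<dots> = inner (transpose X) (B ** transpose Y)"
    by (simp add: inner_matrix_mul_left)
  also have "\<dots> = inner X (Y ** transpose B)"
    by (metis inner_transpose_transpose matrix_transpose_mul transpose_transpose)
  finally show ?thesis .
qed

text \<open>The range of \<open>A\<close> meets the kernel of its transpose only in zero.\<close>

lemma gram_mul_cancel:
  fixes A :: "real ^ 'n ^ 'm" and X :: "real ^ 'p ^ 'n"
  assumes "transpose A ** (A ** X) = 0"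
  shows "A ** X = 0"
proof -
  have "inner (A ** X) (A ** X) = 0"
    using inner_matrix_mul_left[of A X "A ** X"] assms by simp
  then show ?thesis by simp
qed

text \<open>
  Pairing the left-hand side with \<open>K\<close> gives \<open>\<parallel>A K\<parallel>\<^sup>2 + \<parallel>K B\<parallel>\<^sup>2\<close>. This is where
  positive semidefiniteness of the two coefficients enters: a homogeneous Sylvester equation can
  otherwise have solutions with neither summand zero.
\<close>

lemma gram_sylvester_homogeneous:
  fixes A :: "real ^ 'n ^ 'm" and K :: "real ^ 'p ^ 'n" and B :: "real ^ 'q ^ 'p"
  assumes "transpose A ** (A ** K) + (K ** B) ** transpose B = 0"
  shows "A ** K = 0" and "K ** B = 0"
proof -
  have "inner (A ** K) (A ** K) + inner (K ** B) (K ** B)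
      = inner K (transpose A ** (A ** K) + (K ** B) ** transpose B)"
    by (simp only: inner_matrix_mul_left[of A K] inner_matrix_mul_right[of K B] inner_add_right)
  also have "\<dots> = 0"
    using assms by simp
  finally have "inner (A ** K) (A ** K) = 0 \<and> inner (K ** B) (K ** B) = 0"
    by (simp add: add_nonneg_eq_0_iff)
  then show "A ** K = 0" and "K ** B = 0"
    by simp_all
qed

lemma symmetric_if_transpose_mul_self:
  fixes M :: "real ^ 'n ^ 'n"
  assumes "transpose M ** M = M"
  shows "transpose M = M"
  using assms by (metis matrix_transpose_mul transpose_transpose)

text \<open>
  The two summands deviate from \<open>A\<close> by opposite errors. Flanking with \<open>A\<^sup>T\<close> turns both errors
  into products of a Gram matrix with the same \<open>K\<close>, which is what makes the Sylvester equation
  homogeneous with positive semidefinite coefficients.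
\<close>

lemma ah_ha_halves:
  fixes A :: "real ^ 'n ^ 'm" and H :: "real ^ 'm ^ 'n"
  assumes eq: "A ** transpose A ** transpose H + transpose H ** transpose A ** A = 2 *\<^sub>R A"
  shows "A ** transpose A ** transpose H = A" and "transpose H ** transpose A ** A = A"
proof -
  let ?T = "transpose A" and ?G = "transpose H"
  define K where "K = ?T ** ?G ** ?T - ?T"
  have "?T ** (A ** K) + (K ** A) ** ?T
      = ?T ** (A ** ?T ** ?G + ?G ** ?T ** A - A - A) ** ?T"
    unfolding K_def matrix_diff_ldistrib matrix_diff_rdistrib matrix_add_ldistrib
      matrix_add_rdistrib matrix_mul_assoc
    by simp
  then have "?T ** (A ** K) + (K ** A) ** ?T = 0"
    using eq by (simp add: scaleR_2)
  then have KA: "K ** A = 0"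
    by (rule gram_sylvester_homogeneous(2))
  have left: "A ** (?T ** ?G - mat 1) = A ** ?T ** ?G - A"
    by (simp add: matrix_diff_ldistrib matrix_mul_assoc)
  have right: "A ** ?T ** ?G - A = A - ?G ** ?T ** A"
    using eq by (simp only: scaleR_2 diff_eq_eq diff_add_eq eq_diff_eq)
  have "?T ** (A ** (?T ** ?G - mat 1)) = - (K ** A)"
    unfolding left right
    unfolding K_def matrix_diff_ldistrib matrix_diff_rdistrib matrix_mul_assoc
    by simp
  then have zero: "A ** (?T ** ?G - mat 1) = 0"
    unfolding KA minus_zero by (rule gram_mul_cancel)
  show "A ** ?T ** ?G = A"
    using zero unfolding left by simp
  then show "?G ** ?T ** A = A"
    using right by simp
qed

theorem theorem17:
  fixes A :: "real ^ 'n ^ 'm" and H :: "real ^ 'm ^ 'n"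
  shows "(A ** H ** A = A \<and> transpose (A ** H) = A ** H \<and> transpose (H ** A) = H ** A)
    \<longleftrightarrow> A ** transpose A ** transpose H + transpose H ** transpose A ** A = 2 *\<^sub>R A"
proof
  assume *: "A ** H ** A = A \<and> transpose (A ** H) = A ** H \<and> transpose (H ** A) = H ** A"
  have "A ** transpose A ** transpose H = A ** transpose (H ** A)"
    by (simp add: matrix_transpose_mul matrix_mul_assoc)
  also have "\<dots> = A"
    using * by (simp add: matrix_mul_assoc)
  finally have "A ** transpose A ** transpose H = A" .
  moreover have "transpose H ** transpose A ** A = A"
    using * by (simp flip: matrix_transpose_mul)
  ultimately show "A ** transpose A ** transpose H + transpose H ** transpose A ** A = 2 *\<^sub>R A"
    by (simp add: scaleR_2)
next
  assume "A ** transpose A ** transpose H + transpose H ** transpose A ** A = 2 *\<^sub>R A"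
  note halves = ah_ha_halves[OF this]
  have AH: "transpose (A ** H) ** A = A"
    using halves(2) by (simp add: matrix_transpose_mul)
  then have "transpose (A ** H) ** (A ** H) = A ** H"
    by (simp add: matrix_mul_assoc)
  then have symAH: "transpose (A ** H) = A ** H"
    by (rule symmetric_if_transpose_mul_self)
  \<comment> \<open>The argument for \<open>A H\<close>, applied to the transposed pair, makes \<open>(H A)\<^sup>T\<close> symmetric.\<close>
  have "transpose (transpose (H ** A)) ** transpose (H ** A)
      = H ** (A ** transpose A ** transpose H)"
    by (simp add: matrix_transpose_mul matrix_mul_assoc)
  also have "\<dots> = H ** A"
    using halves(1) by simp
  finally have "transpose (H ** A) = H ** A"
    by (metis matrix_transpose_mul transpose_transpose)
  with AH symAH show "A ** H ** A = A \<and> transpose (A ** H) = A ** H \<and> transpose (H ** A) = H ** A"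
    by simp
qed

end
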